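(* Let $p\ge2$, $s\in(0,1)$, $M>0$, let $\Omega\subset\mathbb{R}^n$ be a bounded domain, and let $u$ be a minimizer of $\mathcal I_M$ in $\Omega$. Then $(-\Delta)^s_p u=0$ weakly in $\Omega\cap\{u>0\}$.
   Context: $W^{s,p}(\mathbb{R}^n)$ is the space of $u\in L^p(\mathbb{R}^n)$ with $\int_{\mathbb{R}^n}\int_{\mathbb{R}^n}\frac{|u(x)-u(y)|^p}{|x-y|^{n+sp}}\,dx\,dy<\infty$. The functional is $\mathcal I_M(u):=\int_{\mathbb{R}^n}\int_{\mathbb{R}^n}\frac{|u(x)-u(y)|^p}{|x-y|^{n+sp}}\,dx\,dy+M\,|\{u>0\}\cap\Omega|$. Given $g\in W^{s,p}(\mathbb{R}^n)$, $\mathcal A_g(\Omega):=\{v\in W^{s,p}(\mathbb{R}^n): v=g\text{ a.e. in }\mathbb{R}^n\setminus\Omega\}$. A minimizer of $\mathcal I_M$ in $\Omega$ is a function $u\in\mathcal A_g(\Omega)$, for some exterior datum $g\in W^{s,p}(\mathbb{R}^n)$ with $g\ge0$ a.e. in $\mathbb{R}^n\setminus\Omega$, such that $\mathcal I_M(u)\le\mathcal I_M(v)$ for every $v\in\mathcal A_g(\Omega)$. Minimizers are locally Hölder continuous in $\Omega$ after modification on a null set, and $u$ is identified in $\Omega$ with its continuous representative, so that $\Omega\cap\{u>0\}$ is open. For an open set $D\subset\Omega$, $W^{s,p}_0(D):=\{\varphi\in W^{s,p}(\mathbb{R}^n):\varphi=0\text{ a.e. in }\mathbb{R}^n\setminus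 D\}$. The equation $(-\Delta)^s_p u=0$ weakly in $D$ means that $\int_{\mathbb{R}^n}\int_{\mathbb{R}^n}\frac{|u(x)-u(y)|^{p-2}(u(x)-u(y))(\varphi(x)-\varphi(y))}{|x-y|^{n+sp}}\,dx\,dy=0$ for every $\varphi\in W^{s,p}_0(D)$. *)

theory Defs
  imports "HOL-Analysis.Analysis"
begin

(* The type real^'n is R^n with n = CARD('n).  Functions are Lebesgue measurable pointwise
   representatives.  On the diagonal x = y the quotients below evaluate to 0 / 0 = 0; the
   diagonal is a null set. *)

definition seminorm_density ::
    "real \<Rightarrow> real \<Rightarrow> (real^'n \<Rightarrow> real) \<Rightarrow> (real^'n) \<times> (real^'n) \<Rightarrow> real" where
  "seminorm_density s p u = (\<lambda>(x, y).
     \<bar>u x - u y\<bar> powr p / norm (x - y) powr (real CARD('n) + s * p))"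

definition seminorm_integral :: "real \<Rightarrow> real \<Rightarrow> (real^'n \<Rightarrow> real) \<Rightarrow> ennreal" where
  "seminorm_integral s p u =
     (\<integral>\<^sup>+ z. ennreal (seminorm_density s p u z) \<partial>(lebesgue \<Otimes>\<^sub>M lebesgue))"

definition fractional_Sobolev :: "real \<Rightarrow> real \<Rightarrow> (real^'n \<Rightarrow> real) set" where
  "fractional_Sobolev s p =
     {u. u \<in> borel_measurable lebesgue
       \<and> integrable lebesgue (\<lambda>x. \<bar>u x\<bar> powr p)
       \<and> seminorm_integral s p u < \<infinity>}"

definition energy ::
    "real \<Rightarrow> real \<Rightarrow> real \<Rightarrow> (real^'n) set \<Rightarrow> (real^'n \<Rightarrow> real) \<Rightarrow> ennreal" where
  "energy s p M \<Omega> u =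
     seminorm_integral s p u + ennreal M * emeasure lebesgue ({x. u x > 0} \<inter> \<Omega>)"

definition admissible ::
    "real \<Rightarrow> real \<Rightarrow> (real^'n \<Rightarrow> real) \<Rightarrow> (real^'n) set \<Rightarrow> (real^'n \<Rightarrow> real) set" where
  "admissible s p g \<Omega> =
     {v \<in> fractional_Sobolev s p. AE x in lebesgue. x \<notin> \<Omega> \<longrightarrow> v x = g x}"

definition is_minimizer ::
    "real \<Rightarrow> real \<Rightarrow> real \<Rightarrow> (real^'n) set \<Rightarrow> (real^'n \<Rightarrow> real) \<Rightarrow> bool" where
  "is_minimizer s p M \<Omega> u \<longleftrightarrow>
     (\<exists>g \<in> fractional_Sobolev s p.
        (AE x in lebesgue. x \<notin> \<Omega> \<longrightarrow> g x \<ge> 0)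
        \<and> u \<in> admissible s p g \<Omega>
        \<and> (\<forall>v \<in> admissible s p g \<Omega>. energy s p M \<Omega> u \<le> energy s p M \<Omega> v))"

definition fractional_Sobolev_0 ::
    "real \<Rightarrow> real \<Rightarrow> (real^'n) set \<Rightarrow> (real^'n \<Rightarrow> real) set" where
  "fractional_Sobolev_0 s p D =
     {\<phi> \<in> fractional_Sobolev s p. AE x in lebesgue. x \<notin> D \<longrightarrow> \<phi> x = 0}"

(* For p = 2 and u x = u y the first factor is 0 powr 0 = 0 rather than 1, which is harmless
   since the second factor vanishes. *)

definition weak_form_density ::
    "real \<Rightarrow> real \<Rightarrow> (real^'n \<Rightarrow> real) \<Rightarrow> (real^'n \<Rightarrow> real) \<Rightarrow> (real^'n) \<times> (real^'n) \<Rightarrow> real" where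
  "weak_form_density s p u \<phi> = (\<lambda>(x, y).
     \<bar>u x - u y\<bar> powr (p - 2) * (u x - u y) * (\<phi> x - \<phi> y)
       / norm (x - y) powr (real CARD('n) + s * p))"

(* has_bochner_integral demands absolute convergence, so the equation cannot hold merely
   because the integral of a non-integrable function is 0 by convention. *)

definition weakly_p_harmonic ::
    "real \<Rightarrow> real \<Rightarrow> (real^'n \<Rightarrow> real) \<Rightarrow> (real^'n) set \<Rightarrow> bool" where
  "weakly_p_harmonic s p u D \<longleftrightarrow>
     (\<forall>\<phi> \<in> fractional_Sobolev_0 s p D.
        has_bochner_integral (lebesgue \<Otimes>\<^sub>M lebesgue) (weak_form_density s p u \<phi>) 0)"

end

theory Submission
  imports Defs
begin

text \<open>
  If \<open>\<phi>\<close> vanishes outside \<open>\<Omega> \<inter> {u > 0}\<close>, then \<open>{u + t \<phi> > 0} \<inter> \<Omega>\<close> is contained in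
  \<open>{u > 0} \<inter> \<Omega>\<close> up to a null set for every real \<open>t\<close>, so the competitor \<open>u + t \<phi>\<close> does not increase
  the measure term and minimality passes to the seminorm alone. The tangent inequality for the
  convex function \<open>\<bar>r\<bar>\<^sup>p\<close>, taken at the differences of \<open>w = u + t \<phi>\<close> and integrated, then shows that
  the weak form of \<open>w\<close> tested with \<open>\<phi>\<close> is nonnegative for \<open>t > 0\<close>. Dominated convergence as
  \<open>t \<rightarrow> 0\<close>, for \<open>\<phi>\<close> and for \<open>- \<phi>\<close>, yields the equation.
\<close>

section \<open>Elementary inequalities and continuity for powers of absolute values\<close>

lemma abs_add_powr_le:
  fixes a b p :: real
  assumes "p \<ge> 0"
  shows "(\<bar>a\<bar> + \<bar>b\<bar>) powr p \<le> 2 powr p * (\<bar>a\<bar> powr p + \<bar>b\<bar> powr p)"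
proof -
  have "(\<bar>a\<bar> + \<bar>b\<bar>) powr p \<le> (2 * max \<bar>a\<bar> \<bar>b\<bar>) powr p"
    using assms by (intro powr_mono2) auto
  also have "\<dots> = 2 powr p * max \<bar>a\<bar> \<bar>b\<bar> powr p"
    by (simp add: powr_mult)
  also have "max \<bar>a\<bar> \<bar>b\<bar> powr p \<le> \<bar>a\<bar> powr p + \<bar>b\<bar> powr p"
    by (auto simp: max_def)
  finally show ?thesis by simp
qed

text \<open>Convexity of |r|^p: the graph lies above its tangent at \<open>x\<close>, whose slope is
  p |x|^(p-2) x. Bounding the cross term \<open>x * y\<close> by the product of absolute values
  reduces this to Young's inequality, so no derivative is taken.\<close>

lemma abs_powr_tangent:
  fixes x y p :: real
  assumes p: "p > 1"
  shows "\<bar>x\<bar> powr p + p * (\<bar>x\<bar> powr (p - 2) * x * (y - x)) \<le> \<bar>y\<bar> powr p"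
proof (cases "x = 0")
  case True
  then show ?thesis by simp
next
  case False
  have "\<bar>x\<bar> powr (p - 2) * x * (y - x) = \<bar>x\<bar> powr (p - 2) * (x * y) - \<bar>x\<bar> powr (p - 2) * \<bar>x\<bar> ^ 2"
    by (simp add: algebra_simps power2_eq_square)
  also have "\<bar>x\<bar> powr (p - 2) * \<bar>x\<bar> ^ 2 = \<bar>x\<bar> powr p"
    using False by (simp flip: powr_numeral powr_add del: power2_abs)
  also have "\<bar>x\<bar> powr (p - 2) * (x * y) \<le> \<bar>x\<bar> powr (p - 2) * (\<bar>x\<bar> * \<bar>y\<bar>)"
    by (intro mult_left_mono) (auto simp flip: abs_mult)
  also have "\<dots> = \<bar>x\<bar> powr (p - 1) * \<bar>y\<bar>"
    using False by (simp add: powr_diff field_simps power2_eq_square)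
  finally have 1: "\<bar>x\<bar> powr (p - 2) * x * (y - x) \<le> \<bar>x\<bar> powr (p - 1) * \<bar>y\<bar> - \<bar>x\<bar> powr p"
    by simp
  \<comment> \<open>The conjugate exponents are p/(p-1) and p, chosen so that the first factor,
    raised to its exponent, becomes |x|^p.\<close>
  have "\<bar>x\<bar> powr (p - 1) * \<bar>y\<bar>
      \<le> (\<bar>x\<bar> powr (p - 1)) powr (p / (p - 1)) / (p / (p - 1)) + \<bar>y\<bar> powr p / p"
    using p by (intro Youngs_inequality) (auto simp: field_simps)
  also have "(\<bar>x\<bar> powr (p - 1)) powr (p / (p - 1)) = \<bar>x\<bar> powr p"
    using p by (simp add: powr_powr)
  finally have "p * (\<bar>x\<bar> powr (p - 1) * \<bar>y\<bar>) \<le> p * (\<bar>x\<bar> powr p / (p / (p - 1)) + \<bar>y\<bar> powr p / p)"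
    using p by (intro mult_left_mono) auto
  also have "\<dots> = \<bar>y\<bar> powr p + (p - 1) * \<bar>x\<bar> powr p"
    using p by (simp add: distrib_left)
  finally have "p * (\<bar>x\<bar> powr (p - 1) * \<bar>y\<bar>) \<le> \<bar>y\<bar> powr p + (p - 1) * \<bar>x\<bar> powr p" .
  moreover have "p * (\<bar>x\<bar> powr (p - 2) * x * (y - x)) \<le> p * (\<bar>x\<bar> powr (p - 1) * \<bar>y\<bar> - \<bar>x\<bar> powr p)"
    using 1 p by (intro mult_left_mono) auto
  ultimately show ?thesis by (simp add: algebra_simps)
qed

text \<open>The exponent \<open>p - 1\<close> on the right is positive for p > 1, so absolute values
  and the behaviour at 0 can be read off. At \<open>x = 0\<close> both sides are 0.\<close>

lemma abs_powr_diff_2_times_self: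
  fixes x p :: real
  shows "\<bar>x\<bar> powr (p - 2) * x = sgn x * \<bar>x\<bar> powr (p - 1)"
proof (cases "x = 0")
  case False
  then have "\<bar>x\<bar> powr (p - 2) * \<bar>x\<bar> = \<bar>x\<bar> powr (p - 1)"
    using powr_add[of "\<bar>x\<bar>" "p - 2" 1] by simp
  then show ?thesis
    by (metis mult.assoc mult.commute sgn_mult_abs)
qed simp

text \<open>Only the origin is delicate: there the absolute value is |x|^(p-1), which tends to 0
  because p > 1. Elsewhere the base of the power is nonzero.\<close>

lemma isCont_abs_powr_diff_2_times_self:
  fixes x p :: real
  assumes "p > 1"
  shows "isCont (\<lambda>x. \<bar>x\<bar> powr (p - 2) * x) x"
proof (cases "x = 0")
  case True
  have "((\<lambda>x::real. \<bar>x\<bar> powr (p - 1)) \<longlongrightarrow> \<bar>0\<bar> powr (p - 1)) (at 0)"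
    using assms by (intro tendsto_powr' tendsto_intros) auto
  then have "((\<lambda>x::real. \<bar>x\<bar> powr (p - 1)) \<longlongrightarrow> 0) (at 0)" by simp
  then have "((\<lambda>x::real. \<bar>x\<bar> powr (p - 2) * x) \<longlongrightarrow> 0) (at 0)"
    by (rule Lim_null_comparison[rotated])
      (auto simp: abs_powr_diff_2_times_self abs_mult abs_sgn_eq intro!: always_eventually)
  then show ?thesis using True by (simp add: isCont_def)
next
  case False
  then show ?thesis by (intro continuous_intros) auto
qed

section \<open>Measurability on the product of two Lebesgue spaces\<close>

lemma borel_measurable_fst_lebesgue:
  fixes u :: "'a::euclidean_space \<Rightarrow> real"
  assumes "u \<in> borel_measurable lebesgue"
  shows "(\<lambda>z. u (fst z)) \<in> borel_measurable (lebesgue \<Otimes>\<^sub>M N)"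
  using assms by measurable

lemma borel_measurable_snd_lebesgue:
  fixes u :: "'a::euclidean_space \<Rightarrow> real"
  assumes "u \<in> borel_measurable lebesgue"
  shows "(\<lambda>z. u (snd z)) \<in> borel_measurable (N \<Otimes>\<^sub>M lebesgue)"
  using assms by measurable

lemma borel_measurable_norm_diff_lebesgue:
  "(\<lambda>z::(real^'n) \<times> (real^'n). norm (fst z - snd z))
    \<in> borel_measurable (lebesgue \<Otimes>\<^sub>M lebesgue)"
proof -
  \<comment> \<open>The identity, read as a map from the completed to the Borel sigma-algebra, turns
    each projection into a Borel-valued measurable function.\<close>
  have id: "(\<lambda>x::real^'n. x) \<in> borel_measurable lebesgue"
    by (rule measurable_completion) simp
  let ?L = "lebesgue :: (real^'n) measure"
  have [measurable]: "fst \<in> borel_measurable (?L \<Otimes>\<^sub>M ?L)" "snd \<in> borel_measurable (?L \<Otimes>\<^sub>M ?L)"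
    by (rule measurable_compose[OF measurable_fst id] measurable_compose[OF measurable_snd id])+
  show ?thesis by measurable
qed

lemma borel_measurable_seminorm_density:
  fixes u :: "real^'n \<Rightarrow> real"
  assumes "u \<in> borel_measurable lebesgue"
  shows "seminorm_density s p u \<in> borel_measurable (lebesgue \<Otimes>\<^sub>M lebesgue)"
proof -
  note [measurable] = borel_measurable_fst_lebesgue[OF assms] borel_measurable_snd_lebesgue[OF assms]
    borel_measurable_norm_diff_lebesgue
  show ?thesis unfolding seminorm_density_def case_prod_unfold by measurable
qed

lemma borel_measurable_weak_form_density:
  fixes u \<phi> :: "real^'n \<Rightarrow> real"
  assumes "u \<in> borel_measurable lebesgue" "\<phi> \<in> borel_measurable lebesgue"
  shows "weak_form_density s p u \<phi> \<in> borel_measurable (lebesgue \<Otimes>\<^sub>M lebesgue)"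
proof -
  note [measurable] = assms[THEN borel_measurable_fst_lebesgue]
    assms[THEN borel_measurable_snd_lebesgue] borel_measurable_norm_diff_lebesgue
  show ?thesis unfolding weak_form_density_def case_prod_unfold by measurable
qed

section \<open>Integrable densities and the linear structure of the Sobolev space\<close>

lemma seminorm_density_nonneg: "0 \<le> seminorm_density s p u z"
  by (simp add: seminorm_density_def case_prod_unfold)

lemma seminorm_density_add_le:
  assumes "p \<ge> 0"
  shows "seminorm_density s p (\<lambda>x. u x + v x) z
    \<le> 2 powr p * (seminorm_density s p u z + seminorm_density s p v z)"
proof -
  obtain x y where z: "z = (x, y)" by fastforce
  have "\<bar>u x + v x - (u y + v y)\<bar> powr p \<le> (\<bar>u x - u y\<bar> + \<bar>v x - v y\<bar>) powr p"
    using assms by (intro powr_mono2) auto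
  also have "\<dots> \<le> 2 powr p * (\<bar>u x - u y\<bar> powr p + \<bar>v x - v y\<bar> powr p)"
    using assms by (rule abs_add_powr_le)
  finally show ?thesis
    unfolding z seminorm_density_def by (simp add: divide_right_mono flip: add_divide_distrib)
qed

lemma seminorm_density_cmult:
  "seminorm_density s p (\<lambda>x. t * u x) z = \<bar>t\<bar> powr p * seminorm_density s p u z"
  by (cases z) (simp add: seminorm_density_def abs_mult powr_mult flip: right_diff_distrib)

lemma integrable_seminorm_density:
  assumes "u \<in> fractional_Sobolev s p"
  shows "integrable (lebesgue \<Otimes>\<^sub>M lebesgue) (seminorm_density s p u)"
  using assms
  by (intro integrableI_nonneg)
    (auto simp: fractional_Sobolev_def seminorm_integral_def seminorm_density_nonneg
      borel_measurable_seminorm_density)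

text \<open>Passing to real Bochner integrals allows seminorms to be subtracted from one another in
  the variational argument.\<close>

lemma seminorm_integral_eq:
  assumes "u \<in> fractional_Sobolev s p"
  shows "seminorm_integral s p u
    = ennreal (integral\<^sup>L (lebesgue \<Otimes>\<^sub>M lebesgue) (seminorm_density s p u))"
  unfolding seminorm_integral_def
  by (intro nn_integral_eq_integral integrable_seminorm_density[OF assms])
    (simp add: seminorm_density_nonneg)

lemma fractional_SobolevI:
  assumes "u \<in> borel_measurable lebesgue" "integrable lebesgue (\<lambda>x. \<bar>u x\<bar> powr p)"
    and "integrable (lebesgue \<Otimes>\<^sub>M lebesgue) (seminorm_density s p u)"
  shows "u \<in> fractional_Sobolev s p"
  using assms
  by (simp add: fractional_Sobolev_def seminorm_integral_def nn_integral_eq_integral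
      seminorm_density_nonneg)

lemma fractional_Sobolev_cmult:
  assumes u: "u \<in> fractional_Sobolev s p"
  shows "(\<lambda>x. t * u x) \<in> fractional_Sobolev s p"
proof (rule fractional_SobolevI)
  have [measurable]: "u \<in> borel_measurable lebesgue"
    using u by (simp add: fractional_Sobolev_def)
  show "(\<lambda>x. t * u x) \<in> borel_measurable lebesgue" by measurable
  show "integrable lebesgue (\<lambda>x. \<bar>t * u x\<bar> powr p)"
    using u by (simp add: fractional_Sobolev_def abs_mult powr_mult)
  show "integrable (lebesgue \<Otimes>\<^sub>M lebesgue) (seminorm_density s p (\<lambda>x. t * u x))"
    unfolding seminorm_density_cmult[abs_def]
    using integrable_seminorm_density[OF u] by simp
qed

text \<open>Both integrability conditions follow by domination from \<open>abs_add_powr_le\<close>,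
  applied once to the values and once to the differences.\<close>

lemma fractional_Sobolev_add:
  assumes p: "p \<ge> 0" and u: "u \<in> fractional_Sobolev s p" and v: "v \<in> fractional_Sobolev s p"
  shows "(\<lambda>x. u x + v x) \<in> fractional_Sobolev s p"
proof (rule fractional_SobolevI)
  have [measurable]: "u \<in> borel_measurable lebesgue" "v \<in> borel_measurable lebesgue"
    using u v by (simp_all add: fractional_Sobolev_def)
  show uv: "(\<lambda>x. u x + v x) \<in> borel_measurable lebesgue" by measurable
  have bound: "\<bar>u x + v x\<bar> powr p \<le> 2 powr p * (\<bar>u x\<bar> powr p + \<bar>v x\<bar> powr p)" for x
    by (rule order_trans[OF powr_mono2 abs_add_powr_le]) (use p in auto)
  show "integrable lebesgue (\<lambda>x. \<bar>u x + v x\<bar> powr p)"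
  proof (rule Bochner_Integration.integrable_bound)
    show "integrable lebesgue (\<lambda>x. 2 powr p * (\<bar>u x\<bar> powr p + \<bar>v x\<bar> powr p))"
      using u v by (simp add: fractional_Sobolev_def)
    show "(\<lambda>x. \<bar>u x + v x\<bar> powr p) \<in> borel_measurable lebesgue" by measurable
  qed (use bound in auto)
  show "integrable (lebesgue \<Otimes>\<^sub>M lebesgue) (seminorm_density s p (\<lambda>x. u x + v x))"
  proof (rule Bochner_Integration.integrable_bound)
    show "integrable (lebesgue \<Otimes>\<^sub>M lebesgue)
        (\<lambda>z. 2 powr p * (seminorm_density s p u z + seminorm_density s p v z))"
      using integrable_seminorm_density[OF u] integrable_seminorm_density[OF v] by simp
    show "seminorm_density s p (\<lambda>x. u x + v x) \<in> borel_measurable (lebesgue \<Otimes>\<^sub>M lebesgue)"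
      using uv by (rule borel_measurable_seminorm_density)
  qed (use seminorm_density_add_le[OF p] in
      \<open>auto simp: seminorm_density_nonneg abs_of_nonneg intro!: always_eventually\<close>)
qed

section \<open>The weak form: domination, tangent inequality, one-sided variation\<close>

text \<open>The bound does not depend on \<open>t\<close>, so it gives integrability for each
  \<open>t\<close> and also serves as the majorant when \<open>t\<close> tends to 0.\<close>

lemma abs_weak_form_density_le:
  assumes p: "p > 1" and t: "\<bar>t\<bar> \<le> 1"
  shows "\<bar>weak_form_density s p (\<lambda>x. u x + t * v x) v z\<bar>
    \<le> 2 powr p * (seminorm_density s p u z + seminorm_density s p v z)"
proof -
  obtain x y where z: "z = (x, y)" by fastforce
  define a b where "a = u x - u y" and "b = v x - v y"
  have ab: "u x + t * v x - (u y + t * v y) = a + t * b"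
    by (simp add: a_def b_def algebra_simps)
  have "\<bar>t\<bar> * \<bar>b\<bar> \<le> 1 * \<bar>b\<bar>" using t by (intro mult_right_mono) auto
  then have le: "\<bar>a + t * b\<bar> \<le> \<bar>a\<bar> + \<bar>b\<bar>"
    by (metis abs_triangle_ineq abs_mult add_left_mono mult_1 order_trans)
  have "\<bar>\<bar>a + t * b\<bar> powr (p - 2) * (a + t * b) * b\<bar> \<le> \<bar>a + t * b\<bar> powr (p - 1) * \<bar>b\<bar>"
    by (simp add: abs_powr_diff_2_times_self abs_mult abs_sgn_eq)
  \<comment> \<open>Both |a + t b| and |b| are at most |a| + |b|, and the exponents p - 1 and 1 add
    up to p.\<close>
  also have "\<dots> \<le> (\<bar>a\<bar> + \<bar>b\<bar>) powr (p - 1) * (\<bar>a\<bar> + \<bar>b\<bar>)"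
    using le p by (intro mult_mono powr_mono2) auto
  also have "\<dots> = (\<bar>a\<bar> + \<bar>b\<bar>) powr p"
    using powr_mult_base[of "\<bar>a\<bar> + \<bar>b\<bar>" "p - 1"] by (simp add: mult.commute)
  also have "\<dots> \<le> 2 powr p * (\<bar>a\<bar> powr p + \<bar>b\<bar> powr p)"
    using p by (intro abs_add_powr_le) auto
  finally have "\<bar>\<bar>a + t * b\<bar> powr (p - 2) * (a + t * b) * b\<bar>
      \<le> 2 powr p * (\<bar>a\<bar> powr p + \<bar>b\<bar> powr p)" .
  then show ?thesis
    unfolding z seminorm_density_def weak_form_density_def
    by (simp add: ab abs_divide divide_right_mono flip: add_divide_distrib a_def b_def)
qed

lemma integrable_weak_form_density:
  assumes p: "p > 1" and t: "\<bar>t\<bar> \<le> 1"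
    and u: "u \<in> fractional_Sobolev s p" and v: "v \<in> fractional_Sobolev s p"
  shows "integrable (lebesgue \<Otimes>\<^sub>M lebesgue) (weak_form_density s p (\<lambda>x. u x + t * v x) v)"
proof (rule Bochner_Integration.integrable_bound)
  show "integrable (lebesgue \<Otimes>\<^sub>M lebesgue)
      (\<lambda>z. 2 powr p * (seminorm_density s p u z + seminorm_density s p v z))"
    using integrable_seminorm_density[OF u] integrable_seminorm_density[OF v] by simp
  have [measurable]: "u \<in> borel_measurable lebesgue" "v \<in> borel_measurable lebesgue"
    using u v by (simp_all add: fractional_Sobolev_def)
  show "weak_form_density s p (\<lambda>x. u x + t * v x) v \<in> borel_measurable (lebesgue \<Otimes>\<^sub>M lebesgue)"
    by (intro borel_measurable_weak_form_density) measurable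
qed (use abs_weak_form_density_le[OF p t] in
    \<open>auto simp: seminorm_density_nonneg abs_of_nonneg intro!: always_eventually\<close>)

text \<open>The tangent is taken at the perturbed function, not at \<open>u\<close>: this bounds the
  energy of \<open>u\<close> from below, the direction that can be combined with minimality. A
  tangent at \<open>u\<close> would only bound the competitor from below.\<close>

lemma seminorm_density_tangent:
  assumes "p > 1"
  shows "seminorm_density s p (\<lambda>x. u x + t * v x) z
      - p * t * weak_form_density s p (\<lambda>x. u x + t * v x) v z \<le> seminorm_density s p u z"
proof -
  obtain x y where z: "z = (x, y)" by fastforce
  define a b where "a = u x - u y" and "b = v x - v y"
  have ab: "u x + t * v x - (u y + t * v y) = a + t * b"
    by (simp add: a_def b_def algebra_simps)
  \<comment> \<open>The increment from a + t b to a is - t b, which produces the factor - p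
    t.\<close>
  have "\<bar>a + t * b\<bar> powr p - p * t * (\<bar>a + t * b\<bar> powr (p - 2) * (a + t * b) * b) \<le> \<bar>a\<bar> powr p"
    using abs_powr_tangent[OF assms, of "a + t * b" a] by (simp add: algebra_simps)
  then have "(\<bar>a + t * b\<bar> powr p - p * t * (\<bar>a + t * b\<bar> powr (p - 2) * (a + t * b) * b))
      / norm (x - y) powr (real CARD('a) + s * p)
    \<le> \<bar>a\<bar> powr p / norm (x - y) powr (real CARD('a) + s * p)"
    by (intro divide_right_mono) auto
  then show ?thesis
    unfolding z seminorm_density_def weak_form_density_def
    by (simp add: ab diff_divide_distrib flip: a_def b_def)
qed

lemma weak_form_nonneg:
  fixes u v :: "real^'n \<Rightarrow> real"
  assumes p: "p > 1" and u: "u \<in> fractional_Sobolev s p" and v: "v \<in> fractional_Sobolev s p"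
    and min: "\<And>t. seminorm_integral s p u \<le> seminorm_integral s p (\<lambda>x. u x + t * v x)"
  shows "0 \<le> integral\<^sup>L (lebesgue \<Otimes>\<^sub>M lebesgue) (weak_form_density s p u v)"
proof -
  let ?L = "lebesgue \<Otimes>\<^sub>M (lebesgue :: (real^'n) measure)"
  \<comment> \<open>Positivity permits division by \<open>p * t k\<close>; the bound by 1 makes the
    uniform majorant applicable.\<close>
  define t where "t k = inverse (real (Suc k))" for k
  have t: "t k > 0" "\<bar>t k\<bar> \<le> 1" for k
    by (auto simp: t_def field_simps)
  define W where "W k = weak_form_density s p (\<lambda>x. u x + t k * v x) v" for k
  have [measurable]: "u \<in> borel_measurable lebesgue" "v \<in> borel_measurable lebesgue"
    using u v by (simp_all add: fractional_Sobolev_def)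
  have pos: "0 \<le> integral\<^sup>L ?L (W k)" for k
  proof -
    let ?w = "\<lambda>x. u x + t k * v x"
    have w: "?w \<in> fractional_Sobolev s p"
      using p by (intro fractional_Sobolev_add fractional_Sobolev_cmult u v) auto
    have intW: "integrable ?L (W k)"
      unfolding W_def by (rule integrable_weak_form_density[OF p t(2) u v])
    have "integral\<^sup>L ?L (seminorm_density s p ?w) - p * t k * integral\<^sup>L ?L (W k)
        = integral\<^sup>L ?L (\<lambda>z. seminorm_density s p ?w z - p * t k * W k z)"
      using integrable_seminorm_density[OF w] intW by simp
    also have "\<dots> \<le> integral\<^sup>L ?L (seminorm_density s p u)"
      using integrable_seminorm_density[OF w] intW integrable_seminorm_density[OF u]
        seminorm_density_tangent[OF p]
      by (intro integral_mono) (auto simp: W_def)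
    also have "\<dots> \<le> integral\<^sup>L ?L (seminorm_density s p ?w)"
      using min[of "t k"] unfolding seminorm_integral_eq[OF u] seminorm_integral_eq[OF w]
      by (subst (asm) ennreal_le_iff) (auto simp: seminorm_density_nonneg)
    finally have "0 \<le> (p * t k) * integral\<^sup>L ?L (W k)" by simp
    moreover have "p * t k > 0" using p t(1)[of k] by simp
    ultimately show ?thesis by (simp add: zero_le_mult_iff)
  qed
  have "(\<lambda>k. integral\<^sup>L ?L (W k)) \<longlonglongrightarrow> integral\<^sup>L ?L (weak_form_density s p u v)"
  proof (rule integral_dominated_convergence)
    show "integrable ?L (\<lambda>z. 2 powr p * (seminorm_density s p u z + seminorm_density s p v z))"
      using integrable_seminorm_density[OF u] integrable_seminorm_density[OF v] by simp
    show "weak_form_density s p u v \<in> borel_measurable ?L"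
      by (intro borel_measurable_weak_form_density) measurable
    show "W k \<in> borel_measurable ?L" for k
      unfolding W_def by (intro borel_measurable_weak_form_density) measurable
    show "AE z in ?L. norm (W k z)
        \<le> 2 powr p * (seminorm_density s p u z + seminorm_density s p v z)" for k
      using abs_weak_form_density_le[OF p t(2)] by (auto simp: W_def intro!: always_eventually)
    have "(\<lambda>k. W k z) \<longlonglongrightarrow> weak_form_density s p u v z" for z
    proof -
      obtain x y where z: "z = (x, y)" by fastforce
      \<comment> \<open>All dependence on \<open>k\<close> sits in the argument of \<open>h\<close>;
        the difference of \<open>v\<close> and the kernel form a constant factor, so continuity of
        \<open>h\<close> suffices.\<close>
      define h :: "real \<Rightarrow> real" where "h r = \<bar>r\<bar> powr (p - 2) * r" for r
      have "t \<longlonglongrightarrow> 0"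
        unfolding t_def by (rule LIMSEQ_inverse_real_of_nat)
      then have "(\<lambda>k. u x + t k * v x - (u y + t k * v y)) \<longlonglongrightarrow> u x + 0 * v x - (u y + 0 * v y)"
        by (intro tendsto_intros)
      moreover have "isCont h (u x - u y)"
        unfolding h_def using p by (rule isCont_abs_powr_diff_2_times_self)
      ultimately have "(\<lambda>k. h (u x + t k * v x - (u y + t k * v y))) \<longlonglongrightarrow> h (u x - u y)"
        by (intro isCont_tendsto_compose[of _ h]) auto
      then have "(\<lambda>k. h (u x + t k * v x - (u y + t k * v y))
            * ((v x - v y) / norm (x - y) powr (real CARD('n) + s * p)))
          \<longlonglongrightarrow> h (u x - u y) * ((v x - v y) / norm (x - y) powr (real CARD('n) + s * p))"
        by (rule tendsto_mult_right)
      then show ?thesis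
        by (simp add: W_def z weak_form_density_def h_def)
    qed
    then show "AE z in ?L. (\<lambda>k. W k z) \<longlonglongrightarrow> weak_form_density s p u v z" by simp
  qed
  then show ?thesis
    using pos by (intro LIMSEQ_le_const) auto
qed

section \<open>Competitors of a minimizer and the Euler-Lagrange equation\<close>

text \<open>Perturbing only where \<open>u\<close> is positive can shrink the positivity set in
  \<Omega> but not enlarge it, up to null sets. Hence \<open>t\<close> may have any sign and size,
  and the measure term can be cancelled.\<close>

lemma minimizer_seminorm_le:
  fixes u \<phi> :: "real^'n \<Rightarrow> real"
  assumes p: "p \<ge> 0" and \<Omega>: "open \<Omega>" "bounded \<Omega>"
    and min: "is_minimizer s p M \<Omega> u"
    and \<phi>: "\<phi> \<in> fractional_Sobolev_0 s p (\<Omega> \<inter> {x. u x > 0})"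
  shows "seminorm_integral s p u \<le> seminorm_integral s p (\<lambda>x. u x + t * \<phi> x)"
proof -
  let ?w = "\<lambda>x. u x + t * \<phi> x"
  obtain g where g: "u \<in> admissible s p g \<Omega>"
    and le: "\<And>v. v \<in> admissible s p g \<Omega> \<Longrightarrow> energy s p M \<Omega> u \<le> energy s p M \<Omega> v"
    using min by (auto simp: is_minimizer_def)
  have u: "u \<in> fractional_Sobolev s p" and ug: "AE x in lebesgue. x \<notin> \<Omega> \<longrightarrow> u x = g x"
    using g by (auto simp: admissible_def)
  have \<phi>W: "\<phi> \<in> fractional_Sobolev s p"
    and \<phi>0: "AE x in lebesgue. x \<notin> \<Omega> \<inter> {x. u x > 0} \<longrightarrow> \<phi> x = 0"
    using \<phi> by (auto simp: fractional_Sobolev_0_def)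
  have w: "?w \<in> fractional_Sobolev s p"
    using p by (intro fractional_Sobolev_add fractional_Sobolev_cmult u \<phi>W) auto
  have "AE x in lebesgue. x \<notin> \<Omega> \<longrightarrow> ?w x = g x"
    using ug \<phi>0 by eventually_elim auto
  then have "?w \<in> admissible s p g \<Omega>"
    using w by (simp add: admissible_def)
  from le[OF this] have energy_le: "energy s p M \<Omega> u \<le> energy s p M \<Omega> ?w" .
  have [measurable]: "u \<in> borel_measurable lebesgue" "\<Omega> \<in> sets lebesgue"
    using u \<Omega> by (auto simp: fractional_Sobolev_def)
  have pos_set: "{x. u x > 0} \<in> sets lebesgue"
    using borel_measurable_less[of "\<lambda>x. 0" lebesgue u] by simp
  have measure_le: "emeasure lebesgue ({x. ?w x > 0} \<inter> \<Omega>) \<le> emeasure lebesgue ({x. u x > 0} \<inter> \<Omega>)"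
  proof (rule emeasure_mono_AE)
    \<comment> \<open>At almost every point of \<Omega> with u \<le> 0 the test function vanishes,
      so the competitor equals \<open>u\<close> there.\<close>
    show "AE x in lebesgue. x \<in> {x. ?w x > 0} \<inter> \<Omega> \<longrightarrow> x \<in> {x. u x > 0} \<inter> \<Omega>"
      using \<phi>0 by eventually_elim auto
  qed (use pos_set in auto)
  \<comment> \<open>Cancelling a summand in \<open>ennreal\<close> requires it to be finite;
    boundedness of \<Omega> provides this.\<close>
  have "emeasure lebesgue ({x. u x > 0} \<inter> \<Omega>) \<le> emeasure lebesgue \<Omega>"
    by (intro emeasure_mono) auto
  also have "\<dots> < \<infinity>"
    using emeasure_bounded_finite[OF \<Omega>(2)] \<Omega>(1) by simp
  finally have "ennreal M * emeasure lebesgue ({x. u x > 0} \<inter> \<Omega>) < \<infinity>"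
    by (simp add: ennreal_mult_less_top)
  moreover have "seminorm_integral s p u + ennreal M * emeasure lebesgue ({x. u x > 0} \<inter> \<Omega>)
      \<le> seminorm_integral s p ?w + ennreal M * emeasure lebesgue ({x. u x > 0} \<inter> \<Omega>)"
    using energy_le unfolding energy_def
    by (rule order_trans) (intro add_left_mono mult_left_mono measure_le zero_le)
  ultimately show ?thesis
    using ennreal_add_left_cancel_le[of "ennreal M * emeasure lebesgue ({x. u x > 0} \<inter> \<Omega>)"]
    by (auto simp: add.commute)
qed

theorem corollary1p3:
  fixes s p M :: real and \<Omega> :: "(real^'n) set" and u :: "real^'n \<Rightarrow> real"
  assumes "p \<ge> 2" and "0 < s" and "s < 1" and "M > 0"
    and "open \<Omega>" and "connected \<Omega>" and "\<Omega> \<noteq> {}" and "bounded \<Omega>"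
    and "is_minimizer s p M \<Omega> u"
    and continuous_representative: "continuous_on \<Omega> u"
  shows "weakly_p_harmonic s p u (\<Omega> \<inter> {x. u x > 0})"
  unfolding weakly_p_harmonic_def
proof
  fix \<phi> :: "real^'n \<Rightarrow> real"
  assume \<phi>: "\<phi> \<in> fractional_Sobolev_0 s p (\<Omega> \<inter> {x. u x > 0})"
  let ?L = "lebesgue \<Otimes>\<^sub>M (lebesgue :: (real^'n) measure)"
  have p: "p > 1" "p \<ge> 0" using \<open>p \<ge> 2\<close> by auto
  have u: "u \<in> fractional_Sobolev s p"
    using \<open>is_minimizer s p M \<Omega> u\<close> by (auto simp: is_minimizer_def admissible_def)
  have \<phi>W: "\<phi> \<in> fractional_Sobolev s p"
    using \<phi> by (simp add: fractional_Sobolev_0_def)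
  note min = minimizer_seminorm_le[OF p(2) \<open>open \<Omega>\<close> \<open>bounded \<Omega>\<close> \<open>is_minimizer s p M \<Omega> u\<close> \<phi>]
  \<comment> \<open>The case \<open>t = 0\<close> of the perturbed weak form supplies the absolute
    convergence demanded by \<open>has_bochner_integral\<close>.\<close>
  have int: "integrable ?L (weak_form_density s p u \<phi>)"
    using integrable_weak_form_density[OF p(1) _ u \<phi>W, of 0] by simp
  have "0 \<le> integral\<^sup>L ?L (weak_form_density s p u \<phi>)"
    using p(1) u \<phi>W min by (rule weak_form_nonneg)
  moreover have "0 \<le> integral\<^sup>L ?L (weak_form_density s p u (\<lambda>x. - 1 * \<phi> x))"
  proof (rule weak_form_nonneg[OF p(1) u fractional_Sobolev_cmult[OF \<phi>W]])
    \<comment> \<open>Perturbing by \<phi> with parameter \<open>- t\<close> is the same as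
      perturbing by its negative with parameter \<open>t\<close>.\<close>
    show "seminorm_integral s p u \<le> seminorm_integral s p (\<lambda>x. u x + t * (- 1 * \<phi> x))" for t
      using min[of "- t"] by simp
  qed
  \<comment> \<open>The weak form is odd in the test function, so the two inequalities force its
    integral to be 0.\<close>
  moreover have "weak_form_density s p u (\<lambda>x. - 1 * \<phi> x) = (\<lambda>z. - weak_form_density s p u \<phi> z)"
    by (simp add: weak_form_density_def fun_eq_iff)
      (metis minus_diff_eq mult_minus_right minus_divide_left)
  ultimately show "has_bochner_integral ?L (weak_form_density s p u \<phi>) 0"
    using int by (simp add: has_bochner_integral_iff)
qed

end
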